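(* The stepsize pattern $h=(1.5,4.9,1.5)$ is straightforward. Hence, for every convex $L$-smooth $f:\mathbb{R}^n\to\mathbb{R}$ with minimizer $x_\star$ and every $x_0\in\mathbb{R}^n$ with $D=\sup\{\|x-x_\star\|_2\mid f(x)\le f(x_0)\}<\infty$, gradient descent $x_{k+1}=x_k-\frac{h_{(k\bmod 3)}}{L}\nabla f(x_k)$ cycling through these three stepsizes has, for every $T=3s$, $$ f(x_T)-f(x_\star)\le\frac{LD^2}{2.63333\ldots\times T}+O(1/T^2),$$ where $2.63333\ldots=7.9/3$.
   Context: $L$-smooth means differentiable with $L$-Lipschitz gradient ($L>0$, Euclidean norm). Straightforwardness: for a pattern $h=(h_0,\dots,h_{t-1})\in\mathbb{R}^t$, problem dimension $n$, and $L,D>0$, $p_{L,D}(\delta)$ is the supremum of $f(x_t)-f(x_\star)$ over all convex $L$-smooth $f:\mathbb{R}^n\to\mathbb{R}$ and $x_0,x_\star\in\mathbb{R}^n$ with $\nabla f(x_\star)=0$, $\|x_0-x_\star\|_2\le D$, $f(x_0)-f(x_\star)\le\delta$, where $x_{k+1}=x_k-\frac{h_k}{L}\nabla f(x_k)$ for $k=0,\dots,t-1$. $h$ is straightforward if for some $\Delta\in(0,1/2]$ and any $L,D>0$, $p_{L,D}(\delta)\le\delta-\frac{\sum_{i=0}^{t-1}h_i}{LD^2}\delta^2$ for all $\delta\in[0,LD^2\Delta]$. Convention: "$f(x_T)-f(x_\star)\le\frac{LD^2}{cT}+O(1/T^2)$ for every $T=st$" (here $t=3$) abbreviates that there exist universal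 constants $\bar s$ and $C$ (depending only on the pattern) such that $f(x_T)-f(x_\star)\le\frac{LD^2}{cT-C}$ for all $T=st$ with $s>\bar s$. *)

theory Defs
  imports "HOL-Analysis.Analysis"
begin

section \<open>Euclidean space whose dimension is a term\<close>

text \<open>
  The constants of the rate must not depend on the dimension \<open>n\<close>, so \<open>n\<close> has to be
  quantified inside the statement and cannot be a type. We therefore realise all the spaces
  \<open>\<real>\<^sup>n\<close> as subspaces \<open>Rn n\<close> (the span of the first \<open>n\<close> unit vectors) of
  one inner product space, the finitely supported real sequences with the Euclidean inner product.
  A new type is needed because the library's \<open>poly_mapping\<close> carries a non-Euclidean norm.
\<close>

typedef finseq = "{x :: nat \<Rightarrow> real. finite {i. x i \<noteq> 0}}"
  morphisms coord Abs_finseq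
  by (rule exI[of _ "\<lambda>_. 0"]) simp

setup_lifting type_definition_finseq

lemma finite_coord [simp]: "finite {i. coord x i \<noteq> 0}"
  using coord[of x] by simp

instantiation finseq :: real_inner
begin

lift_definition zero_finseq :: finseq is "\<lambda>_. 0" by simp

lift_definition plus_finseq :: "finseq \<Rightarrow> finseq \<Rightarrow> finseq" is "\<lambda>x y i. x i + y i"
  by (erule (1) rev_finite_subset[OF finite_UnI]) auto

lift_definition minus_finseq :: "finseq \<Rightarrow> finseq \<Rightarrow> finseq" is "\<lambda>x y i. x i - y i"
  by (erule (1) rev_finite_subset[OF finite_UnI]) auto

lift_definition uminus_finseq :: "finseq \<Rightarrow> finseq" is "\<lambda>x i. - x i"
  by simp

lift_definition scaleR_finseq :: "real \<Rightarrow> finseq \<Rightarrow> finseq" is "\<lambda>c x i. c * x i"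
  by (erule rev_finite_subset) auto

definition inner_finseq :: "finseq \<Rightarrow> finseq \<Rightarrow> real" where
  "inner_finseq x y = (\<Sum>i | coord x i \<noteq> 0. coord x i * coord y i)"

definition norm_finseq :: "finseq \<Rightarrow> real" where
  "norm_finseq x = sqrt (inner x x)"

definition dist_finseq :: "finseq \<Rightarrow> finseq \<Rightarrow> real" where
  "dist_finseq x y = norm (x - y)"

definition sgn_finseq :: "finseq \<Rightarrow> finseq" where
  "sgn_finseq x = inverse (norm x) *\<^sub>R x"

definition uniformity_finseq :: "(finseq \<times> finseq) filter" where
  "uniformity_finseq = (INF e\<in>{0 <..}. principal {(x, y). dist x y < e})"

definition open_finseq :: "finseq set \<Rightarrow> bool" where
  "open_finseq U \<longleftrightarrow> (\<forall>x\<in>U. eventually (\<lambda>(x', y). x' = x \<longrightarrow> y \<in> U) uniformity)"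

lemma inner_finseq_superset:
  assumes "finite A" "{i. coord x i \<noteq> 0} \<subseteq> A"
  shows "inner x y = (\<Sum>i\<in>A. coord x i * coord y i)"
  unfolding inner_finseq_def by (rule sum.mono_neutral_left) (use assms in auto)

instance
proof
  fix x y z :: finseq and a b :: real
  show "x + y + z = x + (y + z)" "x + y = y + x" "0 + x = x" "- x + x = 0" "x - y = x + - y"
    "a *\<^sub>R (x + y) = a *\<^sub>R x + a *\<^sub>R y" "(a + b) *\<^sub>R x = a *\<^sub>R x + b *\<^sub>R x"
    "a *\<^sub>R b *\<^sub>R x = (a * b) *\<^sub>R x" "1 *\<^sub>R x = x"
    by (transfer; simp add: algebra_simps fun_eq_iff)+
  show "dist x y = norm (x - y)" by (rule dist_finseq_def)
  show "sgn x = inverse (norm x) *\<^sub>R x" by (rule sgn_finseq_def)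
  show "uniformity = (INF e\<in>{0 <..}. principal {(x :: finseq, y). dist x y < e})"
    by (rule uniformity_finseq_def)
  show "open U \<longleftrightarrow> (\<forall>x\<in>U. eventually (\<lambda>(x', y). x' = x \<longrightarrow> y \<in> U) uniformity)"
    for U :: "finseq set" by (rule open_finseq_def)
  define A where "A = {i. coord x i \<noteq> 0} \<union> {i. coord y i \<noteq> 0}"
  have A: "finite A" by (simp add: A_def)
  have in_A: "inner u v = (\<Sum>i\<in>A. coord u i * coord v i)" if "{i. coord u i \<noteq> 0} \<subseteq> A" for u v
    by (rule inner_finseq_superset) (use A that in auto)
  show "inner x y = inner y x"
    by (subst (1 2) in_A) (auto simp: A_def mult.commute)
  show "inner (x + y) z = inner x z + inner y z"
    by (subst (1 2 3) in_A)
       (auto simp: A_def plus_finseq.rep_eq algebra_simps sum.distrib)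
  show "inner (a *\<^sub>R x) y = a * inner x y"
    by (subst (1 2) in_A)
       (auto simp: A_def scaleR_finseq.rep_eq sum_distrib_left mult.assoc)
  show "0 \<le> inner x x"
    by (simp add: inner_finseq_def sum_nonneg)
  show "inner x x = 0 \<longleftrightarrow> x = 0"
    by (auto simp: inner_finseq_def sum_nonneg_eq_0_iff zero_finseq.rep_eq simp flip: coord_inject)
  show "norm x = sqrt (inner x x)" by (rule norm_finseq_def)
qed

end

definition Rn :: "nat \<Rightarrow> finseq set" where
  "Rn n = {x. \<forall>i\<ge>n. coord x i = 0}"

lemma inner_Rn: "x \<in> Rn n \<Longrightarrow> inner x y = (\<Sum>i<n. coord x i * coord y i)"
  by (rule inner_finseq_superset) (auto simp: Rn_def not_le[symmetric])

lemma norm_Rn: "x \<in> Rn n \<Longrightarrow> norm x = sqrt (\<Sum>i<n. (coord x i)\<^sup>2)"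
  by (simp add: norm_eq_sqrt_inner inner_Rn power2_eq_square)

lemma coord_Rn_onto: "\<exists>x\<in>Rn n. \<forall>i<n. coord x i = c i"
proof -
  have "{i. (if i < n then c i else 0) \<noteq> 0} \<subseteq> {..<n}" by auto
  then have "finite {i. (if i < n then c i else 0) \<noteq> 0}"
    using finite_subset by blast
  then show ?thesis
    by (intro bexI[of _ "Abs_finseq (\<lambda>i. if i < n then c i else 0)"])
       (auto simp: Rn_def Abs_finseq_inverse)
qed

lemma subspace_Rn: "subspace (Rn n)"
  by (auto simp: subspace_def Rn_def zero_finseq.rep_eq plus_finseq.rep_eq scaleR_finseq.rep_eq)

section \<open>Smooth functions and gradient descent\<close>

text \<open>
  A function \<open>f :: finseq \<Rightarrow> real\<close> stands for its restriction to \<open>Rn n\<close>; values outside are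
  irrelevant. Since derivatives are taken within \<open>Rn n\<close>, the gradient is the unique representing
  vector that lies in \<open>Rn n\<close>.
\<close>

definition has_grad :: "nat \<Rightarrow> (finseq \<Rightarrow> real) \<Rightarrow> finseq \<Rightarrow> finseq \<Rightarrow> bool" where
  "has_grad n f x g \<longleftrightarrow> g \<in> Rn n \<and> (f has_derivative (\<lambda>v. inner g v)) (at x within Rn n)"

lemma has_grad_unique:
  assumes x: "x \<in> Rn n" and g: "has_grad n f x g" and g': "has_grad n f x g'"
  shows "g = g'"
proof -
  define d where "d = g - g'"
  have d: "d \<in> Rn n"
    using g g' by (auto simp: d_def has_grad_def intro: subspace_diff subspace_Rn)
  have line: "x + t *\<^sub>R d \<in> Rn n" for t :: real
    using x d subspace_Rn by (intro subspace_add subspace_scale) auto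
  have "((\<lambda>t. f (x + t *\<^sub>R d)) has_derivative (\<lambda>t. inner h (t *\<^sub>R d))) (at (0 :: real))"
    if "has_grad n f x h" for h
  proof -
    have "((\<lambda>t. x + t *\<^sub>R d) has_derivative (\<lambda>t. t *\<^sub>R d)) (at (0 :: real))"
      by (auto intro!: derivative_eq_intros)
    moreover have "(f has_derivative (\<lambda>v. inner h v))
        (at (x + 0 *\<^sub>R d) within range (\<lambda>t::real. x + t *\<^sub>R d))"
      using that line by (auto simp: has_grad_def intro: has_derivative_subset)
    ultimately show ?thesis
      using has_derivative_in_compose[of "\<lambda>t::real. x + t *\<^sub>R d" _ 0 UNIV f] by blast
  qed
  from has_derivative_unique[OF this[OF g] this[OF g']]
  have "inner g (1 *\<^sub>R d) = inner g' (1 *\<^sub>R d)" by metis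
  then have "inner d d = 0" by (simp add: d_def inner_diff_left)
  then show ?thesis by (simp add: d_def)
qed

definition grad :: "nat \<Rightarrow> (finseq \<Rightarrow> real) \<Rightarrow> finseq \<Rightarrow> finseq" where
  "grad n f x = (THE g. has_grad n f x g)"

lemma grad_eqI: "x \<in> Rn n \<Longrightarrow> has_grad n f x g \<Longrightarrow> grad n f x = g"
  unfolding grad_def by (blast intro: has_grad_unique)

definition smooth :: "nat \<Rightarrow> real \<Rightarrow> (finseq \<Rightarrow> real) \<Rightarrow> bool" where
  "smooth n L f \<longleftrightarrow> L > 0 \<and> (\<forall>x\<in>Rn n. \<exists>g. has_grad n f x g) \<and> L-lipschitz_on (Rn n) (grad n f)"

primrec gd :: "nat \<Rightarrow> real \<Rightarrow> (finseq \<Rightarrow> real) \<Rightarrow> (nat \<Rightarrow> real) \<Rightarrow> finseq \<Rightarrow> nat \<Rightarrow> finseq" where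
  "gd n L f h x0 0 = x0"
| "gd n L f h x0 (Suc k) = gd n L f h x0 k - (h k / L) *\<^sub>R grad n f (gd n L f h x0 k)"

section \<open>Straightforward stepsize patterns\<close>

text \<open>The supremum is taken in the extended reals, so that no boundedness has to be presupposed.\<close>

definition worst_case :: "nat \<Rightarrow> real list \<Rightarrow> real \<Rightarrow> real \<Rightarrow> real \<Rightarrow> ereal" where
  "worst_case n h L D \<delta> =
     Sup {ereal (f (gd n L f ((!) h) x0 (length h)) - f xs) | f x0 xs.
            convex_on (Rn n) f \<and> smooth n L f \<and> x0 \<in> Rn n \<and> xs \<in> Rn n \<and>
            grad n f xs = 0 \<and> norm (x0 - xs) \<le> D \<and> f x0 - f xs \<le> \<delta>}"

text \<open>The threshold \<open>\<Delta>\<close> depends on the pattern only, not on the dimension.\<close>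

definition straightforward :: "real list \<Rightarrow> bool" where
  "straightforward h \<longleftrightarrow>
     (\<exists>\<Delta>. 0 < \<Delta> \<and> \<Delta> \<le> 1 / 2 \<and>
        (\<forall>n L D. L > 0 \<longrightarrow> D > 0 \<longrightarrow>
           (\<forall>\<delta>\<in>{0..L * D\<^sup>2 * \<Delta>}.
              worst_case n h L D \<delta> \<le> ereal (\<delta> - sum_list h / (L * D\<^sup>2) * \<delta>\<^sup>2))))"

end

theory Submission
  imports Defs
begin

text \<open>
  The one-pattern bound is a dual certificate for the performance estimation problem. After dividing
  by \<open>L\<close>, write \<open>Q i j\<close> for the interpolation inequality
  \<open>F i - F j - \<langle>g j, x i - x j\<rangle> - \<parallel>g i - g j\<parallel>\<^sup>2 / 2 \<ge> 0\<close>. With a parameter \<open>a\<close> (to be taken as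
  \<open>\<delta> / (L D\<^sup>2)\<close>), the inequalities between the iterates are weighted by \<open>\<lambda> i j + a \<gamma> i j\<close> and those
  between the minimizer and the iterates by \<open>a \<mu> j\<close>. The function values then cancel, and what is
  left of \<open>(1 - 2 H a) (F 0 - F *) + H a\<^sup>2 \<parallel>x 0 - x *\<parallel>\<^sup>2 - (F 3 - F *)\<close>, where \<open>H = 7.9\<close>, is
  \<open>A (g - y) + a B g\<close> with quadratic forms \<open>A\<close>, \<open>B\<close> and \<open>y = a (x 0 - x *)\<close>. For fixed
  \<open>g - y\<close> and \<open>y\<close> this is affine in \<open>a\<close>, so it suffices to write it as a sum of squares for
  \<open>a = 0\<close> and for one positive \<open>a\<close>.

  Used with \<open>a = min (\<delta> / (L D\<^sup>2)) \<Delta>\<close>, the same bound makes the gap decrease by a fixed fraction of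
  \<open>L D\<^sup>2\<close> per cycle until it is at most \<open>\<Delta> L D\<^sup>2\<close>; from then on \<open>\<delta>' \<le> \<delta> - H \<delta>\<^sup>2 / (L D\<^sup>2)\<close>, so
  \<open>1 / \<delta>\<close> grows by \<open>H / (L D\<^sup>2)\<close> per cycle.
\<close>

section \<open>The certificate\<close>

text \<open>With gradients \<open>g\<close> at \<open>x\<close> and \<open>k\<close> at
  \<open>y\<close>, scaled to \<open>L = 1\<close>, \<open>Q \<ge> 0\<close> says that
  \<open>F x - F y\<close> is at least this.\<close>

definition coco_gap :: "'v::real_inner \<Rightarrow> 'v \<Rightarrow> 'v \<Rightarrow> 'v \<Rightarrow> real" where
  "coco_gap x g y k = inner k (x - y) + (norm (g - k))\<^sup>2 / 2"

text \<open>
  The multipliers were found numerically: \<open>\<lambda>\<close> is a unit flow from \<open>0\<close> to \<open>3\<close> making \<open>A\<close> positive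
  definite, \<open>\<mu>\<close> is forced by \<open>\<lambda>\<close> (see \<open>formA_shift\<close>), and \<open>\<gamma>\<close> only has to balance the function values
  of first order in \<open>a\<close>. Both forms place \<open>x 0\<close> at the origin.
\<close>

definition formA :: "'v::real_inner \<Rightarrow> 'v \<Rightarrow> 'v \<Rightarrow> 'v \<Rightarrow> real" where
  "formA g0 g1 g2 g3 =
    (let x1 = - (3/2) *\<^sub>R g0; x2 = x1 - (49/10) *\<^sub>R g1; x3 = x2 - (3/2) *\<^sub>R g2 in
     199/100 * coco_gap 0 g0 x1 g1 + 99/100 * coco_gap x1 g1 0 g0 + 51/100 * coco_gap x1 g1 x2 g2
     + 49/100 * coco_gap x1 g1 x3 g3 + 51/100 * coco_gap x2 g2 x3 g3)"

text \<open>The last four terms are the minimizer inequalities with \<open>xs\<close> moved to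
  \<open>x0\<close>; the correction \<open>inner g (x0 - xs)\<close> cancels against the mixed terms
  of \<open>formA_shift\<close>.\<close>

definition formB :: "'v::real_inner \<Rightarrow> 'v \<Rightarrow> 'v \<Rightarrow> 'v \<Rightarrow> real" where
  "formB g0 g1 g2 g3 =
    (let x1 = - (3/2) *\<^sub>R g0; x2 = x1 - (49/10) *\<^sub>R g1; x3 = x2 - (3/2) *\<^sub>R g2 in
     - 4557/200 * coco_gap 0 g0 x1 g1 - 7 * coco_gap x1 g1 0 g0 - 5999/1000 * coco_gap x1 g1 x2 g2
     - 1901/1000 * coco_gap x1 g1 x3 g3 - 2 * coco_gap x2 g2 x3 g3
     - 3/200 * (- (norm g0)\<^sup>2 / 2) - 1577/200 * (inner g1 x1 - (norm g1)\<^sup>2 / 2)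
     - 3999/1000 * (inner g2 x2 - (norm g2)\<^sup>2 / 2) - 3901/1000 * (inner g3 x3 - (norm g3)\<^sup>2 / 2))"

text \<open>Completing squares in \<open>u0\<close>, \<open>u1\<close>, \<open>u2\<close>,
  \<open>u3\<close> in turn, an exact LDL factorization, leaves four positive pivots.\<close>

lemma formA_nonneg: "0 \<le> formA u0 u1 u2 u3"
proof -
  have "formA u0 u1 u2 u3 =
     (1/200) * (norm (u0 + (1/2) *\<^sub>R u1))\<^sup>2
     + (1591/800) * (norm (u1 + (3978/7955) *\<^sub>R u2 + (3822/7955) *\<^sub>R u3))\<^sup>2
     + (100929/7955000) * (norm (u2 + (45582/33643) *\<^sub>R u3))\<^sup>2
     + (4747/269144) * (norm (u3))\<^sup>2"
    unfolding formA_def coco_gap_def Let_def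
    by (simp add: power2_norm_eq_inner inner_simps inner_commute algebra_simps
        add_divide_distrib diff_divide_distrib)
  then show ?thesis by (simp only:) (intro add_nonneg_nonneg mult_nonneg_nonneg; simp)
qed

text \<open>Elimination as in \<open>formA_nonneg\<close>, with \<open>y\<close> last. The weight
  1/4000 is the positive \<open>a\<close> of the sum of squares and becomes the threshold
  \<Delta>.\<close>

lemma formA_formB_nonneg:
  "0 \<le> formA u0 u1 u2 u3 + 1/4000 * formB (u0 + y) (u1 + y) (u2 + y) (u3 + y)"
proof -
  have "formA u0 u1 u2 u3 + 1/4000 * formB (u0 + y) (u1 + y) (u2 + y) (u3 + y) =
     (3123/800000) * (norm (u0 + (1829/2082) *\<^sub>R u1 + (1333/6940) *\<^sub>R u2 + (3901/20820) *\<^sub>R u3 + (701/2082) *\<^sub>R y))\<^sup>2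
     + (2202214519/1110400000) * (norm (u1 + (11030338041/22022145190) *\<^sub>R u2 + (10618978059/22022145190) *\<^sub>R u3 - (3289871/2202214519) *\<^sub>R y))\<^sup>2
     + (41591455780417/3523543230400000) * (norm (u2 + (56774375558083/41591455780417) *\<^sub>R u3 + (4426313623700/41591455780417) *\<^sub>R y))\<^sup>2
     + (2784119066421/166365823121668) * (norm (u3 + (1590158078077/13920595332105) *\<^sub>R y))\<^sup>2
     + (81851112152/69602976660525) * (norm (y))\<^sup>2"
    unfolding formA_def formB_def coco_gap_def Let_def
    by (simp add: power2_norm_eq_inner inner_simps inner_commute algebra_simps
        add_divide_distrib diff_divide_distrib)
  then show ?thesis by (simp only:) (intro add_nonneg_nonneg mult_nonneg_nonneg; simp)
qed

text \<open>If all gradients equal \<open>y\<close>, the norms in \<open>coco_gap\<close> vanish and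
  the unit flow telescopes to \<open>inner y (x0 - x3)\<close>; the total step 1.5 + 4.9 + 1.5 is
  the factor 79/10. The mixed coefficients are the weights \<mu>.\<close>

lemma formA_shift:
  "formA (g0 - y) (g1 - y) (g2 - y) (g3 - y) =
    formA g0 g1 g2 g3
     - (3/200 * inner g0 y + 1577/200 * inner g1 y + 3999/1000 * inner g2 y + 3901/1000 * inner g3 y)
     + 79/10 * (norm y)\<^sup>2"
  unfolding formA_def coco_gap_def Let_def
  by (simp add: power2_norm_eq_inner inner_simps inner_commute algebra_simps
      add_divide_distrib diff_divide_distrib)

lemma three_step_certificate:
  fixes x0 xs x1 x2 x3 g0 g1 g2 g3 :: "'v::real_inner" and F0 F1 F2 F3 Fs a :: real
  assumes a: "0 \<le> a" "a \<le> 1/4000"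
    and x: "x1 = x0 - (3/2) *\<^sub>R g0" "x2 = x1 - (49/10) *\<^sub>R g1" "x3 = x2 - (3/2) *\<^sub>R g2"
    and q01: "coco_gap x0 g0 x1 g1 \<le> F0 - F1" and q10: "coco_gap x1 g1 x0 g0 \<le> F1 - F0"
    and q12: "coco_gap x1 g1 x2 g2 \<le> F1 - F2" and q13: "coco_gap x1 g1 x3 g3 \<le> F1 - F3"
    and q23: "coco_gap x2 g2 x3 g3 \<le> F2 - F3"
    and s0: "coco_gap xs 0 x0 g0 \<le> Fs - F0" and s1: "coco_gap xs 0 x1 g1 \<le> Fs - F1"
    and s2: "coco_gap xs 0 x2 g2 \<le> Fs - F2" and s3: "coco_gap xs 0 x3 g3 \<le> Fs - F3"
  shows "F3 - Fs \<le> (1 - 2 * (79/10) * a) * (F0 - Fs) + 79/10 * a\<^sup>2 * (norm (x0 - xs))\<^sup>2"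
proof -
  define y where "y = a *\<^sub>R (x0 - xs)"
  \<comment> \<open>Position of \<open>a\<close> between the two endpoints 0 and 1/4000.\<close>
  define \<theta> where "\<theta> = 4000 * a"
  have "0 \<le> (1 - \<theta>) * formA (g0 - y) (g1 - y) (g2 - y) (g3 - y)
      + \<theta> * (formA (g0 - y) (g1 - y) (g2 - y) (g3 - y) + 1/4000 * formB g0 g1 g2 g3)"
    using a formA_nonneg[of "g0 - y" "g1 - y" "g2 - y" "g3 - y"]
      formA_formB_nonneg[of "g0 - y" "g1 - y" "g2 - y" "g3 - y" y]
    by (intro add_nonneg_nonneg[of "(1 - \<theta>) * _"] mult_nonneg_nonneg) (auto simp: \<theta>_def)
  also have "\<dots> = formA (g0 - y) (g1 - y) (g2 - y) (g3 - y) + a * formB g0 g1 g2 g3"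
    by (simp add: \<theta>_def algebra_simps)
  finally have nn: "0 \<le> formA (g0 - y) (g1 - y) (g2 - y) (g3 - y) + a * formB g0 g1 g2 g3" .
  have A: "formA g0 g1 g2 g3 =
      199/100 * coco_gap x0 g0 x1 g1 + 99/100 * coco_gap x1 g1 x0 g0 + 51/100 * coco_gap x1 g1 x2 g2
      + 49/100 * coco_gap x1 g1 x3 g3 + 51/100 * coco_gap x2 g2 x3 g3"
    by (simp add: formA_def coco_gap_def Let_def x)
  have B: "formB g0 g1 g2 g3 =
      - 4557/200 * coco_gap x0 g0 x1 g1 - 7 * coco_gap x1 g1 x0 g0 - 5999/1000 * coco_gap x1 g1 x2 g2
      - 1901/1000 * coco_gap x1 g1 x3 g3 - 2 * coco_gap x2 g2 x3 g3
      + 3/200 * (coco_gap xs 0 x0 g0 + inner g0 (x0 - xs))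
      + 1577/200 * (coco_gap xs 0 x1 g1 + inner g1 (x0 - xs))
      + 3999/1000 * (coco_gap xs 0 x2 g2 + inner g2 (x0 - xs))
      + 3901/1000 * (coco_gap xs 0 x3 g3 + inner g3 (x0 - xs))"
    by (simp add: formB_def coco_gap_def Let_def x inner_simps algebra_simps inner_commute
        add_divide_distrib diff_divide_distrib)
  have y_eqs: "inner g y = a * inner g (x0 - xs)" "(norm y)\<^sup>2 = a\<^sup>2 * (norm (x0 - xs))\<^sup>2" for g
    by (simp_all add: y_def power_mult_distrib)
  \<comment> \<open>An exact identity: after the two forms, every term is the slack of one
    inequality times a weight that is nonnegative for \<open>0 \<le> a \<le> 1/4000\<close>.\<close>
  have "(1 - 2 * (79/10) * a) * (F0 - Fs) + 79/10 * a\<^sup>2 * (norm (x0 - xs))\<^sup>2 - (F3 - Fs) =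
      formA (g0 - y) (g1 - y) (g2 - y) (g3 - y) + a * formB g0 g1 g2 g3
      + (199/100 - 4557/200 * a) * (F0 - F1 - coco_gap x0 g0 x1 g1)
      + (99/100 - 7 * a) * (F1 - F0 - coco_gap x1 g1 x0 g0)
      + (51/100 - 5999/1000 * a) * (F1 - F2 - coco_gap x1 g1 x2 g2)
      + (49/100 - 1901/1000 * a) * (F1 - F3 - coco_gap x1 g1 x3 g3)
      + (51/100 - 2 * a) * (F2 - F3 - coco_gap x2 g2 x3 g3)
      + 3/200 * a * (Fs - F0 - coco_gap xs 0 x0 g0)
      + 1577/200 * a * (Fs - F1 - coco_gap xs 0 x1 g1)
      + 3999/1000 * a * (Fs - F2 - coco_gap xs 0 x2 g2)
      + 3901/1000 * a * (Fs - F3 - coco_gap xs 0 x3 g3)"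
    unfolding formA_shift A B y_eqs
    by (simp add: algebra_simps add_divide_distrib diff_divide_distrib)
  also have "0 \<le> \<dots>"
    using a assms(6-14) by (intro add_nonneg_nonneg[OF _ mult_nonneg_nonneg] nn; simp)
  finally show ?thesis by simp
qed

section \<open>Smooth convex functions\<close>

lemma has_grad_grad: "x \<in> Rn n \<Longrightarrow> smooth n L f \<Longrightarrow> has_grad n f x (grad n f x)"
  unfolding smooth_def by (metis grad_eqI)

lemma grad_in_Rn: "x \<in> Rn n \<Longrightarrow> smooth n L f \<Longrightarrow> grad n f x \<in> Rn n"
  using has_grad_grad by (auto simp: has_grad_def)

lemma line_in_Rn: "x \<in> Rn n \<Longrightarrow> v \<in> Rn n \<Longrightarrow> x + t *\<^sub>R v \<in> Rn n"
  by (intro subspace_add subspace_scale subspace_Rn)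

lemma has_grad_line:
  assumes "x \<in> Rn n" "v \<in> Rn n" "has_grad n f (x + t *\<^sub>R v) g"
  shows "((\<lambda>t. f (x + t *\<^sub>R v)) has_real_derivative inner g v) (at t within S)"
proof -
  have "((\<lambda>t. x + t *\<^sub>R v) has_derivative (\<lambda>t. t *\<^sub>R v)) (at t within S)"
    by (auto intro!: derivative_eq_intros)
  moreover have "(f has_derivative inner g) (at (x + t *\<^sub>R v) within (\<lambda>t. x + t *\<^sub>R v) ` S)"
    using assms line_in_Rn by (auto simp: has_grad_def intro: has_derivative_subset)
  ultimately have "((\<lambda>t. f (x + t *\<^sub>R v)) has_derivative (\<lambda>t. inner g (t *\<^sub>R v))) (at t within S)"
    by (rule has_derivative_in_compose)
  then show ?thesis
    by (rule has_derivative_imp_has_field_derivative) simp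
qed

lemma smooth_descent:
  assumes sm: "smooth n L f" and x: "x \<in> Rn n" and z: "z \<in> Rn n"
  shows "f z \<le> f x + inner (grad n f x) (z - x) + L / 2 * (norm (z - x))\<^sup>2"
proof -
  define v where "v = z - x"
  have v: "v \<in> Rn n" unfolding v_def by (intro subspace_diff subspace_Rn x z)
  \<comment> \<open>Up to a constant, \<open>f\<close> on the segment minus its quadratic upper
    model; the Lipschitz gradient makes the derivative nonpositive.\<close>
  define \<phi> where "\<phi> t = f (x + t *\<^sub>R v) - t * inner (grad n f x) v - L / 2 * t\<^sup>2 * (norm v)\<^sup>2" for t
  have "\<phi> 1 \<le> \<phi> 0"
  proof (rule DERIV_nonpos_imp_nonincreasing[of 0 1])
    fix t :: real assume t: "0 \<le> t" "t \<le> 1"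
    let ?g = "grad n f (x + t *\<^sub>R v)"
    have xt: "x + t *\<^sub>R v \<in> Rn n" by (rule line_in_Rn[OF x v])
    have "(\<phi> has_real_derivative inner ?g v - inner (grad n f x) v - L * t * (norm v)\<^sup>2) (at t)"
      unfolding \<phi>_def
      by (auto intro!: derivative_eq_intros has_grad_line[OF x v] has_grad_grad[OF xt sm])
    moreover have "inner ?g v - inner (grad n f x) v - L * t * (norm v)\<^sup>2 \<le> 0"
    proof -
      have "norm (?g - grad n f x) \<le> L * (t * norm v)"
        using lipschitz_onD[OF _ xt x, of L "grad n f"] sm t by (simp add: smooth_def dist_norm)
      then have "norm (?g - grad n f x) * norm v \<le> L * t * (norm v)\<^sup>2"
        using mult_right_mono[of _ _ "norm v"] by (fastforce simp: power2_eq_square mult.assoc)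
      with norm_cauchy_schwarz[of "?g - grad n f x" v] show ?thesis
        by (simp add: inner_diff_left)
    qed
    ultimately show "\<exists>y. (\<phi> has_real_derivative y) (at t) \<and> y \<le> 0" by blast
  qed simp
  then show ?thesis by (simp add: \<phi>_def v_def)
qed

lemma convex_above_tangent:
  assumes cv: "convex_on (Rn n) f" and sm: "smooth n L f" and y: "y \<in> Rn n" and z: "z \<in> Rn n"
  shows "f y + inner (grad n f y) (z - y) \<le> f z"
proof -
  define v where "v = z - y"
  have v: "v \<in> Rn n" unfolding v_def by (intro subspace_diff subspace_Rn y z)
  have "convex_on UNIV (\<lambda>t. f (y + t *\<^sub>R v))"
  proof (rule convex_onI)
    fix t r s :: real assume t: "0 < t" "t < 1"
    have "y + ((1 - t) *\<^sub>R r + t *\<^sub>R s) *\<^sub>R v = (1 - t) *\<^sub>R (y + r *\<^sub>R v) + t *\<^sub>R (y + s *\<^sub>R v)"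
      by (simp add: algebra_simps)
    then show "f (y + ((1 - t) *\<^sub>R r + t *\<^sub>R s) *\<^sub>R v)
        \<le> (1 - t) * f (y + r *\<^sub>R v) + t * f (y + s *\<^sub>R v)"
      using convex_onD[OF cv, of t "y + r *\<^sub>R v" "y + s *\<^sub>R v"] t line_in_Rn[OF y v] by simp
  qed simp
  moreover have "((\<lambda>t. f (y + t *\<^sub>R v)) has_real_derivative inner (grad n f y) v) (at 0)"
    using has_grad_line[OF y v, of f 0 "grad n f y"] has_grad_grad[OF y sm] by simp
  ultimately have "f (y + 1 *\<^sub>R v) - f (y + 0 *\<^sub>R v) \<ge> inner (grad n f y) v * (1 - 0)"
    by (intro convex_on_imp_above_tangent[where A = UNIV]) auto
  then show ?thesis by (simp add: v_def)
qed

text \<open>The value \<open>f z\<close> lies between the tangent at \<open>y\<close> and the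
  quadratic model at \<open>x\<close>. The chosen \<open>z\<close> minimizes the difference of the
  two and so gives the strongest inequality.\<close>

lemma coco_gap_le:
  assumes cv: "convex_on (Rn n) f" and sm: "smooth n L f" and x: "x \<in> Rn n" and y: "y \<in> Rn n"
  shows "coco_gap x (grad n f x /\<^sub>R L) y (grad n f y /\<^sub>R L) \<le> f x / L - f y / L"
proof -
  have L: "L > 0" using sm by (simp add: smooth_def)
  define v where "v = (grad n f x - grad n f y) /\<^sub>R L"
  define z where "z = x - v"
  have z: "z \<in> Rn n" unfolding z_def v_def
    by (intro subspace_diff subspace_scale subspace_Rn x y grad_in_Rn[OF _ sm])
  have gv: "grad n f x = grad n f y + L *\<^sub>R v" using L by (simp add: v_def)
  have "f y + inner (grad n f y) (z - y) \<le> f x + inner (grad n f x) (z - x) + L / 2 * (norm (z - x))\<^sup>2"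
    using convex_above_tangent[OF cv sm y z] smooth_descent[OF sm x z] by linarith
  then have "inner (grad n f y) (x - y) + L / 2 * (norm v)\<^sup>2 \<le> f x - f y"
    by (simp add: z_def gv inner_simps power2_norm_eq_inner algebra_simps)
  then have "(inner (grad n f y) (x - y) + L / 2 * (norm v)\<^sup>2) / L \<le> (f x - f y) / L"
    using L by (intro divide_right_mono) auto
  moreover have "coco_gap x (grad n f x /\<^sub>R L) y (grad n f y /\<^sub>R L)
      = (inner (grad n f y) (x - y) + L / 2 * (norm v)\<^sup>2) / L"
    using L by (simp add: coco_gap_def v_def add_divide_distrib flip: scaleR_diff_right)
               (simp add: divide_inverse mult.commute)
  ultimately show ?thesis by (simp add: diff_divide_distrib)
qed

section \<open>Gradient steps and the scaled certificate\<close>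

lemma gd_step_in_Rn: "x \<in> Rn n \<Longrightarrow> smooth n L f \<Longrightarrow> x - c *\<^sub>R grad n f x \<in> Rn n"
  by (intro subspace_diff subspace_scale subspace_Rn grad_in_Rn)

text \<open>Dividing values and gradients by \<open>L\<close> reduces this to the certificate, which
  is normalized to \<open>L = 1\<close>.\<close>

lemma three_step_bound:
  assumes cv: "convex_on (Rn n) f" and sm: "smooth n L f"
    and x0: "x0 \<in> Rn n" and xs: "xs \<in> Rn n" and gs: "grad n f xs = 0"
    and a: "0 \<le> a" "a \<le> 1/4000"
    and x: "x1 = x0 - (1.5 / L) *\<^sub>R grad n f x0" "x2 = x1 - (4.9 / L) *\<^sub>R grad n f x1"
      "x3 = x2 - (1.5 / L) *\<^sub>R grad n f x2"
  shows "f x3 - f xs \<le> (1 - 2 * 7.9 * a) * (f x0 - f xs) + 7.9 * a\<^sup>2 * (L * (norm (x0 - xs))\<^sup>2)"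
proof -
  have L: "L > 0" using sm by (simp add: smooth_def)
  have mem: "x1 \<in> Rn n" "x2 \<in> Rn n" "x3 \<in> Rn n"
    by (simp_all add: x gd_step_in_Rn[OF _ sm] x0)
  note q = coco_gap_le[OF cv sm]
  have s: "coco_gap xs 0 z (grad n f z /\<^sub>R L) \<le> f xs / L - f z / L" if "z \<in> Rn n" for z
    using q[OF xs that] by (simp add: gs)
  have c: "1.5 / L = 3/2 * inverse L" "4.9 / L = 49/10 * inverse L"
    using L by (simp_all add: field_simps)
  have "f x3 / L - f xs / L \<le>
      (1 - 2 * (79/10) * a) * (f x0 / L - f xs / L) + 79/10 * a\<^sup>2 * (norm (x0 - xs))\<^sup>2"
  proof (rule three_step_certificate[OF a])
    show "x1 = x0 - (3/2) *\<^sub>R (grad n f x0 /\<^sub>R L)" "x2 = x1 - (49/10) *\<^sub>R (grad n f x1 /\<^sub>R L)"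
      "x3 = x2 - (3/2) *\<^sub>R (grad n f x2 /\<^sub>R L)"
      by (simp_all only: x c scaleR_scaleR)
  qed (rule q s x0 mem)+
  from mult_left_mono[OF this, of L] L show ?thesis
    by (simp add: algebra_simps)
qed

text \<open>The derivative in the direction of the gradient itself is its squared norm, and it
  vanishes at a minimum.\<close>

lemma grad_minimizer:
  assumes sm: "smooth n L f" and xs: "xs \<in> Rn n" and min: "\<forall>x\<in>Rn n. f xs \<le> f x"
  shows "grad n f xs = 0"
proof -
  let ?g = "grad n f xs"
  have g: "?g \<in> Rn n" by (rule grad_in_Rn[OF xs sm])
  have "((\<lambda>t. f (xs + t *\<^sub>R ?g)) has_real_derivative inner ?g ?g) (at 0)"
    using has_grad_line[OF xs g, of f 0 ?g] has_grad_grad[OF xs sm] by simp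
  then have "inner ?g ?g = 0"
    by (rule DERIV_local_min[where d = 1]) (use min line_in_Rn[OF xs g] in auto)
  then show ?thesis by simp
qed

section \<open>The pattern and its rate\<close>

lemma straightforward_pattern: "straightforward [1.5, 4.9, 1.5]"
  unfolding straightforward_def
proof (intro exI[of _ "1/4000"] conjI allI impI ballI)
  fix n :: nat and L D \<delta> :: real
  assume L: "L > 0" and D: "D > 0" and \<delta>: "\<delta> \<in> {0..L * D\<^sup>2 * (1/4000)}"
  let ?h = "[1.5, 4.9, 1.5] :: real list"
  \<comment> \<open>This choice minimizes \<open>(1 - 2 * 7.9 * a) * \<delta> + 7.9 * a\<^sup>2 * (L
    * D\<^sup>2)\<close>; the minimum is the claimed bound.\<close>
  define a where "a = \<delta> / (L * D\<^sup>2)"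
  have K: "L * D\<^sup>2 > 0" using L D by simp
  have \<delta>_eq: "\<delta> = a * (L * D\<^sup>2)" using L D by (simp add: a_def)
  have "0 \<le> a" using \<delta> K by (simp add: a_def)
  moreover have "a \<le> 1/4000"
    unfolding a_def pos_divide_le_eq[OF K] using \<delta> by (simp add: mult.commute)
  ultimately have a: "0 \<le> a" "a \<le> 1/4000" .
  show "worst_case n ?h L D \<delta> \<le> ereal (\<delta> - sum_list ?h / (L * D\<^sup>2) * \<delta>\<^sup>2)"
    unfolding worst_case_def
  proof (rule Sup_least, clarify)
    fix f x0 xs
    assume f: "convex_on (Rn n) f" "smooth n L f" "x0 \<in> Rn n" "xs \<in> Rn n" "grad n f xs = 0"
      and d: "norm (x0 - xs) \<le> D" and \<delta>0: "f x0 - f xs \<le> \<delta>"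
    have "f (gd n L f ((!) ?h) x0 (length ?h)) - f xs
        \<le> (1 - 2 * 7.9 * a) * (f x0 - f xs) + 7.9 * a\<^sup>2 * (L * (norm (x0 - xs))\<^sup>2)"
      by (rule three_step_bound[OF f a refl refl]) (simp add: numeral_3_eq_3)
    \<comment> \<open>Monotone in the initial gap because \<open>a \<le> 1/4000\<close> keeps its
      factor nonnegative.\<close>
    also have "\<dots> \<le> (1 - 2 * 7.9 * a) * \<delta> + 7.9 * a\<^sup>2 * (L * D\<^sup>2)"
      using a L d \<delta>0 by (intro add_mono mult_left_mono power_mono) auto
    also have "\<dots> = \<delta> - sum_list ?h / (L * D\<^sup>2) * \<delta>\<^sup>2"
      using K L D by (simp add: \<delta>_eq field_simps power2_eq_square)
    finally show "ereal (f (gd n L f ((!) ?h) x0 (length ?h)) - f xs)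
        \<le> ereal (\<delta> - sum_list ?h / (L * D\<^sup>2) * \<delta>\<^sup>2)" by simp
  qed
qed auto

section \<open>Solving the recurrence for the gap\<close>

text \<open>\<open>N\<close> is fixed by \<open>H\<close> and \<Delta> before \<delta> and
  \<open>K\<close> are given, which makes the constants of the rate universal. The product form,
  unlike a bound on \<open>1 / \<delta>\<close>, admits zero gaps.\<close>

lemma recurrence_rate:
  fixes H \<Delta> :: real
  assumes "0 < H" "0 < \<Delta>" "2 * H * \<Delta> \<le> 1"
  obtains N :: nat where
    "\<And>\<delta> K k. \<lbrakk>\<And>s. 0 \<le> \<delta> s; \<delta> 0 \<le> K / 2;
       \<And>s a. 0 \<le> a \<Longrightarrow> a \<le> \<Delta> \<Longrightarrow> \<delta> (Suc s) \<le> (1 - 2 * H * a) * \<delta> s + H * a\<^sup>2 * K\<rbrakk>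
       \<Longrightarrow> \<delta> (N + k) * (H * real k) \<le> (K::real)"
proof -
  have H\<Delta>: "0 < H * \<Delta>\<^sup>2" using assms by simp
  \<comment> \<open>Each cycle of the first phase lowers the gap by at least
    \<open>H * \<Delta>\<^sup>2 * K\<close>, so \<open>N\<close> cycles use up the initial
    \<open>K / 2\<close>.\<close>
  then obtain N :: nat where N: "1 / 2 < real N * (H * \<Delta>\<^sup>2)"
    using reals_Archimedean3 by blast
  show thesis
  proof (rule that[of N])
    fix \<delta> :: "nat \<Rightarrow> real" and K :: real and k :: nat
    assume nonneg: "\<And>s. 0 \<le> \<delta> s" and init: "\<delta> 0 \<le> K / 2"
      and rec: "\<And>s a. 0 \<le> a \<Longrightarrow> a \<le> \<Delta> \<Longrightarrow> \<delta> (Suc s) \<le> (1 - 2 * H * a) * \<delta> s + H * a\<^sup>2 * K"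
    have K: "0 \<le> K" using nonneg[of 0] init by linarith
    \<comment> \<open>With \<open>a = \<Delta>\<close> the bound is monotone in
      \<open>\<delta> s\<close>, as \<open>2 * H * \<Delta> \<le> 1\<close>; hence the level
      \<open>\<Delta> * K\<close> is never exceeded again.\<close>
    have decr: "\<delta> (Suc s) \<le> \<Delta> * K" if "\<delta> s \<le> \<Delta> * K" for s
    proof -
      have "\<delta> (Suc s) \<le> (1 - 2 * H * \<Delta>) * \<delta> s + H * \<Delta>\<^sup>2 * K" using rec assms by simp
      also have "\<dots> \<le> (1 - 2 * H * \<Delta>) * (\<Delta> * K) + H * \<Delta>\<^sup>2 * K"
        using that assms by (intro add_right_mono mult_left_mono) auto
      also have "\<dots> = \<Delta> * K - H * \<Delta>\<^sup>2 * K" by (simp add: algebra_simps power2_eq_square)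
      also have "\<dots> \<le> \<Delta> * K" using H\<Delta> K by simp
      finally show ?thesis .
    qed
    have "\<delta> s \<le> \<Delta> * K \<or> \<delta> s \<le> K / 2 - real s * (H * \<Delta>\<^sup>2) * K" for s
    proof (induction s)
      case 0
      then show ?case using init by simp
    next
      case (Suc s)
      show ?case
      proof (cases "\<delta> s \<le> \<Delta> * K")
        case True
        then show ?thesis using decr by blast
      next
        case False
        have "\<delta> (Suc s) \<le> (1 - 2 * H * \<Delta>) * \<delta> s + H * \<Delta>\<^sup>2 * K" using rec assms by simp
        also have "\<dots> = \<delta> s - 2 * (H * \<Delta>) * \<delta> s + H * \<Delta>\<^sup>2 * K" by (simp add: algebra_simps)
        also have "\<dots> \<le> \<delta> s - 2 * (H * \<Delta>) * (\<Delta> * K) + H * \<Delta>\<^sup>2 * K"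
          using False assms by (intro add_right_mono diff_left_mono mult_left_mono) auto
        also have "\<dots> = \<delta> s - (H * \<Delta>\<^sup>2) * K" by (simp add: algebra_simps power2_eq_square)
        finally show ?thesis using False Suc by (auto simp: algebra_simps)
      qed
    qed
    from this[of N] have N_le: "\<delta> N \<le> \<Delta> * K"
    proof
      assume "\<delta> N \<le> K / 2 - real N * (H * \<Delta>\<^sup>2) * K"
      moreover have "1 / 2 * K \<le> real N * (H * \<Delta>\<^sup>2) * K"
        using N K by (intro mult_right_mono) auto
      moreover have "0 \<le> \<Delta> * K" using assms K by simp
      ultimately show ?thesis by linarith
    qed
    have le: "\<delta> (N + k) \<le> \<Delta> * K" for k
      by (induction k) (use N_le decr in auto)
    show "\<delta> (N + k) * (H * real k) \<le> K"
    proof (cases "K = 0")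
      case True
      then show ?thesis using le[of k] nonneg[of "N + k"] by (simp add: order_antisym)
    next
      case False
      with K have K: "K > 0" by simp
      show ?thesis
      proof (induction k)
        case 0
        then show ?case using K by simp
      next
        case (Suc k)
        \<comment> \<open>The minimizing choice again, admissible because the first phase is
          over.\<close>
        define a where "a = \<delta> (N + k) / K"
        have \<delta>_eq: "\<delta> (N + k) = a * K" using K by (simp add: a_def)
        have a: "0 \<le> a" "a \<le> \<Delta>"
          using K nonneg[of "N + k"] le[of k] by (auto simp: a_def field_simps)
        define r where "r = H * a" \<comment> \<open>the step is then \<open>r (1 - r) (k + 1) \<le> (1 + r) (1 - r) \<le> 1\<close>\<close>
        have r: "0 \<le> r" using a assms by (simp add: r_def)
        have "H * a \<le> H * \<Delta>" "0 < H * \<Delta>"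
          using a assms by (simp_all add: mult_left_mono)
        then have r1: "r \<le> 1" using assms unfolding r_def by linarith
        have "r * real k * K \<le> 1 * K"
          using Suc by (simp add: \<delta>_eq r_def algebra_simps)
        then have rk: "r * real k \<le> 1" using K by (simp only: mult_le_cancel_right_pos)
        have "\<delta> (N + Suc k) \<le> (1 - 2 * H * a) * (a * K) + H * a\<^sup>2 * K"
          using rec[OF a, of "N + k"] by (simp add: \<delta>_eq)
        also have "\<dots> = a * (1 - r) * K"
          by (simp add: r_def algebra_simps power2_eq_square)
        finally have "\<delta> (N + Suc k) * (H * real (Suc k)) \<le> a * (1 - r) * K * (H * real (Suc k))"
          using assms by (intro mult_right_mono) auto
        also have "\<dots> = (r * real k + r) * (1 - r) * K"
          by (simp add: r_def algebra_simps)
        also have "\<dots> \<le> (1 + r) * (1 - r) * K"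
          using r r1 rk K by (intro mult_right_mono) auto
        also have "\<dots> = K - r\<^sup>2 * K" by (simp add: algebra_simps power2_eq_square)
        also have "\<dots> \<le> K" using K by simp
        finally show ?case .
      qed
    qed
  qed
qed

text \<open>Supplies the hypotheses of \<open>recurrence_rate\<close> with
  \<open>K = L * D\<^sup>2\<close>. The values at the ends of cycles never exceed
  \<open>f x0\<close>, so \<open>D\<close> bounds the distance of these iterates to
  \<open>xs\<close>.\<close>

lemma cyclic_gd_recurrence:
  fixes h :: "real list" and n L f x0
  defines "x \<equiv> \<lambda>s. gd n L f (\<lambda>k. h ! (k mod 3)) x0 (3 * s)"
  assumes h: "h = [1.5, 4.9, 1.5]" and sm: "smooth n L f" and cv: "convex_on (Rn n) f"
    and xs: "xs \<in> Rn n" and min: "\<forall>x\<in>Rn n. f xs \<le> f x" and x0: "x0 \<in> Rn n"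
    and bdd: "bdd_above {norm (x - xs) | x. x \<in> Rn n \<and> f x \<le> f x0}"
    and D: "D = Sup {norm (x - xs) | x. x \<in> Rn n \<and> f x \<le> f x0}"
  shows "f (x 0) - f xs \<le> L * D\<^sup>2 / 2" "0 \<le> f (x s) - f xs"
    "0 \<le> a \<Longrightarrow> a \<le> 1/4000 \<Longrightarrow>
      f (x (Suc s)) - f xs \<le> (1 - 2 * 7.9 * a) * (f (x s) - f xs) + 7.9 * a\<^sup>2 * (L * D\<^sup>2)"
proof -
  have L: "L > 0" using sm by (simp add: smooth_def)
  have gs: "grad n f xs = 0" by (rule grad_minimizer[OF sm xs min])
  have dist: "norm (z - xs) \<le> D" if "z \<in> Rn n" "f z \<le> f x0" for z
    unfolding D by (rule cSup_upper[OF _ bdd]) (use that in auto)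
  have step: "f (x (Suc s)) - f xs
      \<le> (1 - 2 * 7.9 * a) * (f (x s) - f xs) + 7.9 * a\<^sup>2 * (L * (norm (x s - xs))\<^sup>2)"
    if "x s \<in> Rn n" "0 \<le> a" "a \<le> 1/4000" for s a
  proof -
    have m: "Suc (3 * s) mod 3 = 1" "Suc (Suc (3 * s)) mod 3 = 2" by presburger+
    have e: "3 * Suc s = Suc (Suc (Suc (3 * s)))" by simp
    show ?thesis
      unfolding x_def e
      by (rule three_step_bound[OF cv sm that(1)[unfolded x_def] xs gs that(2,3)])
         (simp_all only: gd.simps m, simp_all add: h)
  qed
  have in_Rn: "gd n L f (\<lambda>k. h ! (k mod 3)) x0 k \<in> Rn n" for k
    by (induction k) (simp_all add: x0 gd_step_in_Rn[OF _ sm])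
  have lev: "f (x s) \<le> f x0" for s
  proof (induction s)
    case (Suc s)
    \<comment> \<open>For \<open>a = 0\<close> the three-step bound says that a full cycle does not
      increase \<open>f\<close>.\<close>
    then show ?case using step[of s 0] in_Rn by (simp add: x_def)
  qed (simp add: x_def)
  have "f x0 - f xs \<le> L / 2 * (norm (x0 - xs))\<^sup>2"
    using smooth_descent[OF sm xs x0] by (simp add: gs)
  also have "\<dots> \<le> L / 2 * D\<^sup>2"
    using L dist[OF x0] by (intro mult_left_mono power_mono) auto
  finally show "f (x 0) - f xs \<le> L * D\<^sup>2 / 2" by (simp add: x_def)
  show "0 \<le> f (x s) - f xs" using min in_Rn by (simp add: x_def)
  show "f (x (Suc s)) - f xs \<le> (1 - 2 * 7.9 * a) * (f (x s) - f xs) + 7.9 * a\<^sup>2 * (L * D\<^sup>2)"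
    if a: "0 \<le> a" "a \<le> 1/4000"
  proof -
    have "norm (x s - xs) \<le> D" using dist lev in_Rn by (simp add: x_def)
    then have "7.9 * a\<^sup>2 * (L * (norm (x s - xs))\<^sup>2) \<le> 7.9 * a\<^sup>2 * (L * D\<^sup>2)"
      using L by (intro mult_left_mono power_mono) auto
    moreover have "x s \<in> Rn n" by (simp add: x_def in_Rn)
    ultimately show ?thesis using step[of s a] a by linarith
  qed
qed

theorem theorem3p3:
  fixes h :: "real list"
  assumes "h = [1.5, 4.9, 1.5]"
  shows "straightforward h \<and>
    (\<exists>(sbar :: nat) (C :: real).
       \<forall>(n :: nat) (L :: real) (f :: finseq \<Rightarrow> real) (xs :: finseq) (x0 :: finseq) (D :: real).
         smooth n L f \<longrightarrow> convex_on (Rn n) f \<longrightarrow>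
         xs \<in> Rn n \<longrightarrow> (\<forall>x\<in>Rn n. f xs \<le> f x) \<longrightarrow> x0 \<in> Rn n \<longrightarrow>
         bdd_above {norm (x - xs) | x. x \<in> Rn n \<and> f x \<le> f x0} \<longrightarrow>
         D = Sup {norm (x - xs) | x. x \<in> Rn n \<and> f x \<le> f x0} \<longrightarrow>
         (\<forall>s T. s > sbar \<longrightarrow> T = 3 * s \<longrightarrow>
            f (gd n L f (\<lambda>k. h ! (k mod 3)) x0 T) - f xs
              \<le> L * D\<^sup>2 / ((7.9 / 3) * real T - C)))"
proof
  show "straightforward h" using straightforward_pattern assms by simp
  obtain N :: nat where N:
    "\<And>\<delta> K k. \<lbrakk>\<And>s. 0 \<le> \<delta> s; \<delta> 0 \<le> K / 2;
       \<And>s a. 0 \<le> a \<Longrightarrow> a \<le> 1/4000 \<Longrightarrow> \<delta> (Suc s) \<le> (1 - 2 * 7.9 * a) * \<delta> s + 7.9 * a\<^sup>2 * K\<rbrakk>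
       \<Longrightarrow> \<delta> (N + k) * (7.9 * real k) \<le> (K::real)"
    by (rule recurrence_rate[of "7.9" "1/4000"]) auto
  show "\<exists>(sbar :: nat) (C :: real).
       \<forall>(n :: nat) (L :: real) (f :: finseq \<Rightarrow> real) (xs :: finseq) (x0 :: finseq) (D :: real).
         smooth n L f \<longrightarrow> convex_on (Rn n) f \<longrightarrow>
         xs \<in> Rn n \<longrightarrow> (\<forall>x\<in>Rn n. f xs \<le> f x) \<longrightarrow> x0 \<in> Rn n \<longrightarrow>
         bdd_above {norm (x - xs) | x. x \<in> Rn n \<and> f x \<le> f x0} \<longrightarrow>
         D = Sup {norm (x - xs) | x. x \<in> Rn n \<and> f x \<le> f x0} \<longrightarrow>
         (\<forall>s T. s > sbar \<longrightarrow> T = 3 * s \<longrightarrow>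
            f (gd n L f (\<lambda>k. h ! (k mod 3)) x0 T) - f xs
              \<le> L * D\<^sup>2 / ((7.9 / 3) * real T - C))"
  \<comment> \<open>With \<open>C = 7.9 * N\<close> the denominator is \<open>7.9 * (s - N)\<close>,
    counting only the cycles after the first phase; \<open>s > N\<close> makes it positive.\<close>
  proof (intro exI[of _ N] exI[of _ "7.9 * real N"] allI impI)
    fix n L f xs x0 D and s T :: nat
    assume A: "smooth n L f" "convex_on (Rn n) f" "xs \<in> Rn n" "\<forall>x\<in>Rn n. f xs \<le> f x" "x0 \<in> Rn n"
      "bdd_above {norm (x - xs) | x. x \<in> Rn n \<and> f x \<le> f x0}"
      "D = Sup {norm (x - xs) | x. x \<in> Rn n \<and> f x \<le> f x0}"
      and s: "s > N" and T: "T = 3 * s"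
    define \<delta> where "\<delta> s = f (gd n L f (\<lambda>k. h ! (k mod 3)) x0 (3 * s)) - f xs" for s
    note rec = cyclic_gd_recurrence[OF assms A, folded \<delta>_def]
    have "\<delta> (N + (s - N)) * (7.9 * real (s - N)) \<le> L * D\<^sup>2"
      by (rule N) (rule rec; assumption?)+
    moreover have "7.9 / 3 * real T - 7.9 * real N = 7.9 * real (s - N)"
      using s by (simp add: T of_nat_diff algebra_simps)
    moreover have "0 < 7.9 * real (s - N)" "N + (s - N) = s" using s by simp_all
    ultimately show "f (gd n L f (\<lambda>k. h ! (k mod 3)) x0 T) - f xs
        \<le> L * D\<^sup>2 / ((7.9 / 3) * real T - 7.9 * real N)"
      by (simp only: pos_le_divide_eq \<delta>_def T)
  qed
qed

end
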